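(* Let $(\leq_A)_{A \subseteq S}$ be a family of binary relations on acts satisfying postulates (Q1)--(Q4). Let $A, B \subseteq S$ with $A \cap B = \emptyset$ and let $f, g, f', g'$ be acts. If $f =_A f'$, $g =_A g'$, $f =_B g$ and $f' =_B g'$, then $f \leq_{A \cup B} g$ implies $f' \leq_{A \cup B} g'$.
   Context: $S$ is a non-empty set of states, $F$ a set of consequences; events are arbitrary subsets of $S$; acts are arbitrary functions $S \to F$. For each event $A$ a binary relation $\leq_A$ on acts is given. Write $f \sim_A g$ for ($f \leq_A g$ and $g \leq_A f$), and $f =_A g$ if $f(s)=g(s)$ for all $s \in A$. For disjoint $A,B$, write $A \,\mathcal{N}\, B$ if for all acts $h,h'$: $h \leq_{A\cup B} h' \Leftrightarrow h \leq_B h'$. Postulates (for all acts $f,g,h$ and events $A,B$): (Q1) $f \leq_A g$ and $g \leq_A h$ imply $f \leq_A h$. (Q2) $f =_A g$ implies $f \sim_A g$ (in particular $\leq_A$ is reflexive). (Q3) if $A \cap B = \emptyset$, $f \leq_A g$ and $f \sim_B g$, then $f \leq_{A \cup B} g$. (Q4) if $A \cap B = \emptyset$, $f \leq_{A\cup B} g$ and $f \sim_B g$, then either $f \leq_A g$ or $A \,\mathcal{N}\, B$. *)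

theory Defs imports Main
begin

text \<open>
  States are the elements of a type \<open>'s\<close>, consequences those of a type \<open>'c\<close>, so that an act is
  an arbitrary function \<open>'s \<Rightarrow> 'c\<close> and an event an arbitrary set of type \<open>'s set\<close>. A family of
  relations on acts indexed by events is written \<open>le\<close>, where \<open>le A f g\<close> reads \<open>f \<le>\<^sub>A g\<close>.
\<close>

type_synonym ('s, 'c) act = "'s \<Rightarrow> 'c"

type_synonym ('s, 'c) pref_family = "'s set \<Rightarrow> ('s, 'c) act \<Rightarrow> ('s, 'c) act \<Rightarrow> bool"

definition eq_on :: "'s set \<Rightarrow> ('s, 'c) act \<Rightarrow> ('s, 'c) act \<Rightarrow> bool"
  where "eq_on A f g \<longleftrightarrow> (\<forall>s\<in>A. f s = g s)"

definition indiff :: "('s, 'c) pref_family \<Rightarrow> 's set \<Rightarrow> ('s, 'c) act \<Rightarrow> ('s, 'c) act \<Rightarrow> bool"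
  where "indiff le A f g \<longleftrightarrow> le A f g \<and> le A g f"

text \<open>The relation \<open>A \<N> B\<close>; it is only meant for disjoint events \<open>A\<close> and \<open>B\<close>.\<close>

definition negligible :: "('s, 'c) pref_family \<Rightarrow> 's set \<Rightarrow> 's set \<Rightarrow> bool"
  where "negligible le A B \<longleftrightarrow> (\<forall>h h'. le (A \<union> B) h h' \<longleftrightarrow> le B h h')"

definition Q1 :: "('s, 'c) pref_family \<Rightarrow> bool"
  where "Q1 le \<longleftrightarrow> (\<forall>A f g h. le A f g \<and> le A g h \<longrightarrow> le A f h)"

definition Q2 :: "('s, 'c) pref_family \<Rightarrow> bool"
  where "Q2 le \<longleftrightarrow> (\<forall>A f g. eq_on A f g \<longrightarrow> indiff le A f g)"

definition Q3 :: "('s, 'c) pref_family \<Rightarrow> bool"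
  where "Q3 le \<longleftrightarrow>
    (\<forall>A B f g. A \<inter> B = {} \<and> le A f g \<and> indiff le B f g \<longrightarrow> le (A \<union> B) f g)"

text \<open>The alternative in \<open>Q4\<close> is inclusive.\<close>

definition Q4 :: "('s, 'c) pref_family \<Rightarrow> bool"
  where "Q4 le \<longleftrightarrow>
    (\<forall>A B f g. A \<inter> B = {} \<and> le (A \<union> B) f g \<and> indiff le B f g \<longrightarrow>
      le A f g \<or> negligible le A B)"

end

theory Submission imports Defs
begin

text \<open>Agreement on \<open>B\<close> gives indifference there, so \<open>Q4\<close> cancels
  \<open>B\<close>: either \<open>f\<close> and \<open>g\<close> compare on \<open>A\<close> alone,
  a comparison that passes to \<open>f'\<close> and \<open>g'\<close> and extends back over
  \<open>B\<close> by \<open>Q3\<close>, or \<open>A\<close> is negligible beside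
  \<open>B\<close>.\<close>

theorem lemma5:
  fixes le :: "('s, 'c) pref_family"
    and A B :: "'s set"
    and f g f' g' :: "('s, 'c) act"
  assumes "Q1 le" and "Q2 le" and "Q3 le" and "Q4 le"
    and "A \<inter> B = {}"
    and "eq_on A f f'" and "eq_on A g g'"
    and "eq_on B f g" and "eq_on B f' g'"
    and "le (A \<union> B) f g"
  shows "le (A \<union> B) f' g'"
proof -
  have "indiff le B f g" "indiff le B f' g'"
    and ind_A: "indiff le A f f'" "indiff le A g g'"
    using assms unfolding Q2_def by blast+
  then consider "le A f g" | "negligible le A B"
    using assms unfolding Q4_def by blast
  then show ?thesis
  proof cases
    case 1
    then have "le A f' g'"
      using ind_A \<open>Q1 le\<close> unfolding Q1_def indiff_def by blast
    then show ?thesis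
      using \<open>Q3 le\<close> \<open>A \<inter> B = {}\<close> \<open>indiff le B f' g'\<close> unfolding Q3_def by blast
  next
    case 2
    \<comment> \<open>Now \<open>le (A \<union> B)\<close> is just \<open>le B\<close>, which ranks
      \<open>f'\<close> and \<open>g'\<close> as indifferent.\<close>
    then show ?thesis
      using \<open>indiff le B f' g'\<close> unfolding negligible_def indiff_def by blast
  qed
qed

end
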